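(* Let $q\in\mathbb{C}$ with $0<|q|<1$, let $h\in\mathbb{Z}$, $r\in\mathbb{Z}_{\ge 0}$, and $x,y\in\mathbb{R}$. For all integers $m,n\ge 0$, $$\sum_{k=0}^m \binom{m}{k}\, q^{(n+k)x}\,E_{n+k,q}^{(h,r)}(y)\,[x]_q^{m-k} =\sum_{k=0}^n \binom{n}{k}\, E_{m+k,q}^{(h,r)}(x+y)\,q^{(n-k)x}\,[-x]_q^{n-k}.$$
   Context: Fix a logarithm $\log q$ of $q$ and set $q^y=\exp(y\log q)$ for real $y$. The $q$-number is $[y]_q=\frac{1-q^y}{1-q}$. The convention $0^0=1$ is used. Write $(z:q)_r=(1-z)(1-zq)\cdots(1-zq^{r-1})$. The $(h,q)$-extension of the higher-order Euler polynomials is $$E_{n,q}^{(h,r)}(x)=\frac{[2]_q^r}{(1-q)^n}\sum_{l=0}^n\binom{n}{l}\frac{(-q^x)^l}{(-q^{h-r+l+1}:q)_r},\qquad (-q^x)^l=(-1)^lq^{lx}.$$ When the following series converges (i.e. $h\ge r$ or $r=0$), this equals $$[2]_q^r\sum_{m_1,\dots,m_r=0}^\infty q^{\sum_{j=1}^r(h-j+1)m_j}(-1)^{m_1+\cdots+m_r}[m_1+\cdots+m_r+x]_q^n,$$ the coefficient of $t^n/n!$ in $[2]_q^r\sum_{m_1,\dots,m_r\ge0} q^{\sum_{j=1}^r(h-j+1)m_j}(-1)^{\sum_j m_j}e^{[m_1+\cdots+m_r+x]_qt}$. *)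

theory Defs
  imports Complex_Main
begin

text \<open>
  Throughout, \<open>lq\<close> is an arbitrary but fixed logarithm of the base \<open>q\<close>, i.e. \<open>exp lq = q\<close>;
  it need not be the principal one, which is why \<open>powr\<close> is not used for real powers of \<open>q\<close>.
\<close>

definition qpow :: "complex \<Rightarrow> real \<Rightarrow> complex" where
  "qpow lq y = exp (of_real y * lq)"

definition qnum :: "complex \<Rightarrow> complex \<Rightarrow> real \<Rightarrow> complex" where
  "qnum q lq y = (1 - qpow lq y) / (1 - q)"

text \<open>The shifted factorial \<open>(z : q)\<^sub>r = (1 - z) (1 - z q) \<dots> (1 - z q\<^bsup>r-1\<^esup>)\<close>.\<close>

definition qshift :: "complex \<Rightarrow> complex \<Rightarrow> nat \<Rightarrow> complex" where
  "qshift z q r = (\<Prod>i<r. 1 - z * q ^ i)"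

text \<open>
  The \<open>(h,q)\<close>-extension of the Euler polynomials of order \<open>r\<close> at \<open>x\<close>, with \<open>(-q\<^sup>x)\<^sup>l\<close> read as
  \<open>(-1)\<^sup>l q\<^bsup>lx\<^esup>\<close>. The exponent \<open>h - r + l + 1\<close> may be negative, hence \<open>powi\<close>. For \<open>0 < |q| < 1\<close> no
  denominator vanishes, since no integer power of \<open>q\<close> equals \<open>-1\<close>.
\<close>

definition hq_euler :: "complex \<Rightarrow> complex \<Rightarrow> int \<Rightarrow> nat \<Rightarrow> nat \<Rightarrow> real \<Rightarrow> complex" where
  "hq_euler q lq h r n x =
     qnum q lq 2 ^ r / (1 - q) ^ n *
       (\<Sum>l\<le>n. of_nat (n choose l) * ((-1) ^ l * qpow lq (real l * x)) /
               qshift (- (q powi (h - int r + int l + 1))) q r)"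

end

theory Submission
  imports Defs "HOL-Computational_Algebra.Polynomial"
begin

text \<open>
  The proof is umbral. Up to the constant \<open>[2]\<^sub>q\<^sup>r / (1-q)\<^sup>n\<close>, the number \<open>E\<^sub>n(x)\<close> is the image of the
  polynomial \<open>(1 - q\<^sup>x T)\<^sup>n\<close> under the linear functional \<open>T\<^sup>l \<mapsto> 1 / (-q\<^bsup>h-r+l+1\<^esup> : q)\<^sub>r\<close>
  (lemma \<open>hq_euler_umbral\<close>); formally \<open>T\<close> stands for \<open>q\<^bsup>m\<^sub>1 + \<dots> + m\<^sub>r\<^esup>\<close> under the multiple
  series. By linearity the two sides of the theorem are the images of two polynomials in \<open>T\<close>. Both
  of these equal \<open>(1 - q\<^bsup>x+y\<^esup> T)\<^sup>m (q\<^sup>x - q\<^bsup>x+y\<^esup> T)\<^sup>n\<close>: with \<open>A = 1 - q\<^sup>y T\<close> and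
  \<open>B = 1 - q\<^bsup>x+y\<^esup> T\<close> the two linear relations

    \<open>q\<^sup>x A + (1 - q\<^sup>x) = B\<close> and \<open>B + q\<^sup>x (1 - q\<^bsup>-x\<^esup>) = q\<^sup>x A\<close>

  turn the sums over \<open>k\<close> into binomial expansions (lemma \<open>binomial_exchange\<close>). The identity
  is thus one of polynomials, preserved by every linear functional.
\<close>

text \<open>
  Cutting the sum at a fixed \<open>N\<close> rather than at the degree makes linearity immediate; the value
  is the intended one for every polynomial of degree at most \<open>N\<close>.
\<close>

definition moment_functional :: "(nat \<Rightarrow> 'a) \<Rightarrow> nat \<Rightarrow> 'a::comm_semiring_0 poly \<Rightarrow> 'a" where
  "moment_functional a N p = (\<Sum>l\<le>N. coeff p l * a l)"

lemma moment_functional_smult: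
  "moment_functional a N (smult c p) = c * moment_functional a N p"
  by (simp add: moment_functional_def sum_distrib_left mult.assoc)

lemma moment_functional_sum:
  "moment_functional a N (\<Sum>i\<in>I. p i) = (\<Sum>i\<in>I. moment_functional a N (p i))"
proof -
  have "moment_functional a N (\<Sum>i\<in>I. p i) = (\<Sum>l\<le>N. \<Sum>i\<in>I. coeff (p i) l * a l)"
    by (simp add: moment_functional_def coeff_sum sum_distrib_right)
  also have "\<dots> = (\<Sum>i\<in>I. moment_functional a N (p i))"
    unfolding moment_functional_def by (rule sum.swap)
  finally show ?thesis .
qed

lemma moment_functional_linear_power:
  fixes c :: "'a::comm_ring_1"
  assumes "n \<le> N"
  shows "moment_functional a N ([:1, c:] ^ n) = (\<Sum>l\<le>n. of_nat (n choose l) * c ^ l * a l)"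
proof -
  have "coeff ([:1, c:] ^ n) l = 0" if "n < l" for l
    using degree_power_le[of "[:1, c:]" n] that
    by (intro coeff_eq_0) (auto split: if_splits)
  then have "moment_functional a N ([:1, c:] ^ n) = (\<Sum>l\<le>n. coeff ([:1, c:] ^ n) l * a l)"
    unfolding moment_functional_def using assms by (intro sum.mono_neutral_right) auto
  then show ?thesis
    by (simp add: coeff_linear_poly_power)
qed

lemma qpow_add: "qpow lq (x + y) = qpow lq x * qpow lq y"
  by (simp add: qpow_def ring_distribs exp_add)

lemma qpow_of_nat_mult: "qpow lq (real k * x) = qpow lq x ^ k"
  by (simp add: qpow_def mult.assoc exp_of_nat_mult)

lemma qpow_mult_minus: "qpow lq x * qpow lq (- x) = 1"
  by (simp add: qpow_def flip: exp_add)

lemma hq_euler_umbral: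
  assumes "n \<le> N"
  shows "hq_euler q lq h r n x = qnum q lq 2 ^ r / (1 - q) ^ n *
     moment_functional (\<lambda>l. 1 / qshift (- (q powi (h - int r + int l + 1))) q r) N
       ([:1, - qpow lq x:] ^ n)"
  using assms
  by (simp add: hq_euler_def moment_functional_linear_power qpow_of_nat_mult
      power_minus[of "qpow lq x"] mult.assoc)

text \<open>
  Both sides are binomial expansions of \<open>B ^ m * (u * A) ^ n\<close>, the left one of the factor \<open>B ^ m\<close>
  and the right one of the factor \<open>(u * A) ^ n\<close>. The intended instances are polynomials in \<open>T\<close>,
  with \<open>u\<close> and \<open>v\<close> the constant polynomials \<open>q\<^sup>x\<close> and \<open>q\<^bsup>-x\<^esup>\<close>.
\<close>

lemma binomial_exchange:
  fixes A B u v :: "'a::comm_ring_1"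
  assumes "u * v = 1" and "B = u * A + (1 - u)"
  shows "(\<Sum>k\<le>m. of_nat (m choose k) * u ^ (n + k) * A ^ (n + k) * (1 - u) ^ (m - k))
       = (\<Sum>k\<le>n. of_nat (n choose k) * B ^ (m + k) * u ^ (n - k) * (1 - v) ^ (n - k))"
proof -
  have uA: "u * A = B + u * (1 - v)"
    using assms by (simp add: algebra_simps)
  have "(\<Sum>k\<le>m. of_nat (m choose k) * u ^ (n + k) * A ^ (n + k) * (1 - u) ^ (m - k))
      = (u * A) ^ n * B ^ m"
    unfolding assms(2) binomial_ring[of "u * A"] sum_distrib_left
    by (intro sum.cong) (auto simp: power_add power_mult_distrib mult_ac)
  also have "\<dots> = (\<Sum>k\<le>n. of_nat (n choose k) * B ^ (m + k) * u ^ (n - k) * (1 - v) ^ (n - k))"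
    unfolding uA binomial_ring[of B] sum_distrib_right
    by (intro sum.cong) (auto simp: power_add power_mult_distrib mult_ac)
  finally show ?thesis .
qed

theorem theorem2p5:
  fixes q lq :: complex and h :: int and r m n :: nat and x y :: real
  assumes "0 < norm q" and "norm q < 1"
    and "exp lq = q"
  shows "(\<Sum>k\<le>m. of_nat (m choose k) * qpow lq (real (n + k) * x)
                  * hq_euler q lq h r (n + k) y * qnum q lq x ^ (m - k))
       = (\<Sum>k\<le>n. of_nat (n choose k) * hq_euler q lq h r (m + k) (x + y)
                  * qpow lq (real (n - k) * x) * qnum q lq (- x) ^ (n - k))"
proof -
  define u v where "u = qpow lq x" and "v = qpow lq (- x)"
  define A B where "A = [:1, - qpow lq y:]" and "B = [:1, - qpow lq (x + y):]"
  define L where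
    "L = moment_functional (\<lambda>l. 1 / qshift (- (q powi (h - int r + int l + 1))) q r) (m + n)"
  define C where "C = qnum q lq 2 ^ r / (1 - q) ^ (m + n)"
  have E: "hq_euler q lq h r j z = qnum q lq 2 ^ r / (1 - q) ^ j * L ([:1, - qpow lq z:] ^ j)"
    if "j \<le> m + n" for j z
    unfolding L_def using that by (rule hq_euler_umbral)
  have L_sum: "L (\<Sum>i\<in>I. smult (c i) (p i)) = (\<Sum>i\<in>I. c i * L (p i))"
    for c and p :: "nat \<Rightarrow> complex poly" and I
    by (simp add: L_def moment_functional_sum moment_functional_smult)
  have "[:u:] * [:v:] = 1"
    using qpow_mult_minus[of lq x] by (simp add: mult.commute u_def v_def one_pCons)
  moreover have "B = [:u:] * A + (1 - [:u:])"
    by (simp add: A_def B_def u_def qpow_add one_pCons)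
  ultimately have "(\<Sum>k\<le>m. of_nat (m choose k) * [:u:] ^ (n + k) * A ^ (n + k) * (1 - [:u:]) ^ (m - k))
      = (\<Sum>k\<le>n. of_nat (n choose k) * B ^ (m + k) * [:u:] ^ (n - k) * (1 - [:v:]) ^ (n - k))"
    by (rule binomial_exchange)
  then have poly_eq:
    "(\<Sum>k\<le>m. smult (of_nat (m choose k) * u ^ (n + k) * (1 - u) ^ (m - k)) (A ^ (n + k)))
      = (\<Sum>k\<le>n. smult (of_nat (n choose k) * u ^ (n - k) * (1 - v) ^ (n - k)) (B ^ (m + k)))"
    by (simp add: of_nat_poly poly_const_pow one_pCons mult_ac)
  have "(\<Sum>k\<le>m. of_nat (m choose k) * qpow lq (real (n + k) * x)
                  * hq_euler q lq h r (n + k) y * qnum q lq x ^ (m - k))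
      = C * L (\<Sum>k\<le>m. smult (of_nat (m choose k) * u ^ (n + k) * (1 - u) ^ (m - k)) (A ^ (n + k)))"
    unfolding L_sum sum_distrib_left
  proof (intro sum.cong refl)
    fix k assume "k \<in> {..m}"
    then have "(1 - q) ^ (m + n) = (1 - q) ^ (n + k) * (1 - q) ^ (m - k)"
      by (simp add: add.commute flip: power_add)
    then show "of_nat (m choose k) * qpow lq (real (n + k) * x)
                  * hq_euler q lq h r (n + k) y * qnum q lq x ^ (m - k)
        = C * (of_nat (m choose k) * u ^ (n + k) * (1 - u) ^ (m - k) * L (A ^ (n + k)))"
      using \<open>k \<in> {..m}\<close> unfolding qpow_of_nat_mult
      by (simp add: E C_def A_def u_def qnum_def[of _ _ x] power_divide)
  qed
  also have "\<dots> = (\<Sum>k\<le>n. of_nat (n choose k) * hq_euler q lq h r (m + k) (x + y)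
                  * qpow lq (real (n - k) * x) * qnum q lq (- x) ^ (n - k))"
    unfolding poly_eq L_sum sum_distrib_left
  proof (intro sum.cong refl)
    fix k assume "k \<in> {..n}"
    then have "(1 - q) ^ (m + n) = (1 - q) ^ (m + k) * (1 - q) ^ (n - k)"
      by (simp flip: power_add)
    then show "C * (of_nat (n choose k) * u ^ (n - k) * (1 - v) ^ (n - k) * L (B ^ (m + k)))
        = of_nat (n choose k) * hq_euler q lq h r (m + k) (x + y)
                  * qpow lq (real (n - k) * x) * qnum q lq (- x) ^ (n - k)"
      using \<open>k \<in> {..n}\<close> unfolding qpow_of_nat_mult
      by (simp add: E C_def B_def u_def v_def qnum_def[of _ _ "- x"] power_divide)
  qed
  finally show ?thesis .
qed

end
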